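(* For every fixed $r\ge 3$, as $t\to\infty$, \[ (1+o(1))\frac{\sqrt{2}}{e}\, t\, \sqrt{2}^{\,t} < R^r(SK_t,SK_t)\le R^2(K_t,K_t)+(r-2). \]
   Context: For a graph $G=(V,E)$ and $r\ge 3$, the $r$-suspension $SG$ is the $r$-uniform hypergraph obtained by taking a fixed set $U$ of $r-2$ new vertices and setting $V(SG)=V\cup U$, $E(SG)=\{e\cup U: e\in E\}$. $K_t$ is the complete graph on $t$ vertices. For $r$-uniform hypergraphs $\mathcal{F}_1,\mathcal{F}_2$, $R^r(\mathcal{F}_1,\mathcal{F}_2)$ is the least $N$ such that every 2-coloring of the hyperedges of the complete $r$-uniform hypergraph on $N$ vertices contains a subhypergraph of the first color isomorphic to $\mathcal{F}_1$ or one of the second color isomorphic to $\mathcal{F}_2$; $R^2(K_t,K_t)$ is the classical graph Ramsey number. *)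

theory Defs
  imports Complex_Main "HOL-Library.Ramsey" "HOL-Library.Landau_Symbols"
begin

type_synonym 'a hypergraph = "'a set \<times> 'a set set"

abbreviation hverts :: "'a hypergraph \<Rightarrow> 'a set" where
  "hverts H \<equiv> fst H"

abbreviation hedges :: "'a hypergraph \<Rightarrow> 'a set set" where
  "hedges H \<equiv> snd H"

definition complete_hypergraph :: "nat \<Rightarrow> nat \<Rightarrow> nat hypergraph" where
  "complete_hypergraph r n = ({..<n}, nsets {..<n} r)"

abbreviation complete_graph :: "nat \<Rightarrow> nat hypergraph" where
  "complete_graph t \<equiv> complete_hypergraph 2 t"

text \<open>The sum type makes the \<open>r - 2\<close> added vertices disjoint from the old ones.\<close>

definition suspension :: "nat \<Rightarrow> 'a hypergraph \<Rightarrow> ('a + nat) hypergraph" where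
  "suspension r G =
     (let U = Inr ` {..<r - 2}
      in (Inl ` hverts G \<union> U, (\<lambda>e. Inl ` e \<union> U) ` hedges G))"

definition subhypergraph :: "'a hypergraph \<Rightarrow> 'a hypergraph \<Rightarrow> bool" where
  "subhypergraph H K \<longleftrightarrow>
     hverts H \<subseteq> hverts K \<and> hedges H \<subseteq> hedges K \<and> hedges H \<subseteq> Pow (hverts H)"

definition hypergraph_iso :: "'a hypergraph \<Rightarrow> 'b hypergraph \<Rightarrow> bool" where
  "hypergraph_iso F H \<longleftrightarrow>
     (\<exists>f. bij_betw f (hverts F) (hverts H) \<and> hedges H = (\<lambda>e. f ` e) ` hedges F)"

definition has_monochromatic_copy ::
    "('a set \<Rightarrow> bool) \<Rightarrow> bool \<Rightarrow> 'a hypergraph \<Rightarrow> 'b hypergraph \<Rightarrow> bool" where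
  "has_monochromatic_copy c i K F \<longleftrightarrow>
     (\<exists>H. subhypergraph H K \<and> (\<forall>e \<in> hedges H. c e = i) \<and> hypergraph_iso F H)"

text \<open>Colourings are total functions; their values off the hyperedges are irrelevant.\<close>

definition hypergraph_ramsey :: "nat \<Rightarrow> 'a hypergraph \<Rightarrow> 'b hypergraph \<Rightarrow> nat" where
  "hypergraph_ramsey r F1 F2 =
     (LEAST N. \<forall>c :: nat set \<Rightarrow> bool.
        has_monochromatic_copy c True (complete_hypergraph r N) F1 \<or>
        has_monochromatic_copy c False (complete_hypergraph r N) F2)"

end

theory Submission
  imports Defs "HOL-Real_Asymp.Real_Asymp"
begin

text \<open>
  Upper bound: fix \<open>r - 2\<close> vertices \<open>U\<close> and colour a pair \<open>e\<close> of the remaining vertices with the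
  colour of \<open>e \<union> U\<close>; a monochromatic \<open>K\<^sub>t\<close> then suspends to a monochromatic \<open>SK\<^sub>t\<close>.

  Lower bound: colour the \<open>r\<close>-sets of \<open>{..<n}\<close> at random and apply the Lovasz local lemma to the
  events that a given copy of \<open>SK\<^sub>t\<close> is monochromatic. Each has probability
  \<open>2 / 2 ^ (t choose 2)\<close>, and shares a hyperedge with at most
  \<open>(t choose 2) * (r choose 2) * (n choose (t - 2))\<close> copies. The suspension only contributes the
  constant \<open>r choose 2\<close>, which disappears when one takes the \<open>(t - 2)\<close>-th root to solve for \<open>n\<close>, so
  the bound agrees asymptotically with Spencer's bound for graphs.
\<close>

section \<open>Two-colourings of set systems with bounded overlap\<close>

text \<open>A two-colouring of \<open>E\<close> is encoded by its first colour class
  \<open>C\<close>. Counting such \<open>C\<close> replaces probability under the uniform random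
  colouring.\<close>

definition proper_splits :: "'a set \<Rightarrow> 'a set set \<Rightarrow> 'a set set" where
  "proper_splits E S = {C \<in> Pow E. \<forall>g\<in>S. g \<inter> C \<noteq> {} \<and> \<not> g \<subseteq> C}"

lemma finite_proper_splits: "finite E \<Longrightarrow> finite (proper_splits E S)"
  by (simp add: proper_splits_def)

lemma proper_splits_antimono: "S' \<subseteq> S \<Longrightarrow> proper_splits E S \<subseteq> proper_splits E S'"
  by (auto simp: proper_splits_def)

text \<open>Independence in counting form: no member of \<open>S\<close> meets \<open>f\<close>, so
  a colouring of \<open>E\<close> is a free choice on \<open>f\<close> together with a colouring of
  \<open>E - f\<close> that alone decides whether \<open>S\<close> is split.\<close>

lemma card_proper_splits_Int:
  assumes "finite E" "f \<subseteq> E" and disj: "\<And>g. g \<in> S \<Longrightarrow> g \<inter> f = {}"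
  shows "card {C \<in> proper_splits E S. P (C \<inter> f)}
       = card {A \<in> Pow f. P A} * card (proper_splits (E - f) S)"
proof -
  have "bij_betw (\<lambda>(A, B). A \<union> B) ({A \<in> Pow f. P A} \<times> proper_splits (E - f) S)
          {C \<in> proper_splits E S. P (C \<inter> f)}"
  proof (rule bij_betw_byWitness[where f' = "\<lambda>C. (C \<inter> f, C - f)"])
    show "(\<lambda>(A, B). A \<union> B) ` ({A \<in> Pow f. P A} \<times> proper_splits (E - f) S)
            \<subseteq> {C \<in> proper_splits E S. P (C \<inter> f)}"
    proof (rule image_subsetI)
      fix x assume "x \<in> {A \<in> Pow f. P A} \<times> proper_splits (E - f) S"
      then obtain A B where x: "x = (A, B)" and A: "A \<subseteq> f" "P A"
        and B: "B \<in> proper_splits (E - f) S" by auto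
      have "(A \<union> B) \<inter> f = A"
        using A B by (auto simp: proper_splits_def)
      moreover have "g \<inter> (A \<union> B) = g \<inter> B" "g \<subseteq> A \<union> B \<longleftrightarrow> g \<subseteq> B" if "g \<in> S" for g
        using disj[OF that] A(1) by auto
      then have "A \<union> B \<in> proper_splits E S"
        using A B assms(2) by (auto simp: proper_splits_def)
      ultimately show "(case x of (A, B) \<Rightarrow> A \<union> B) \<in> {C \<in> proper_splits E S. P (C \<inter> f)}"
        using A x by simp
    qed
    show "(\<lambda>C. (C \<inter> f, C - f)) ` {C \<in> proper_splits E S. P (C \<inter> f)}
            \<subseteq> {A \<in> Pow f. P A} \<times> proper_splits (E - f) S"
    proof (rule image_subsetI)
      fix C assume "C \<in> {C \<in> proper_splits E S. P (C \<inter> f)}"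
      then have C: "C \<in> proper_splits E S" "P (C \<inter> f)" by auto
      have "g \<inter> (C - f) = g \<inter> C" "g \<subseteq> C - f \<longleftrightarrow> g \<subseteq> C" if "g \<in> S" for g
        using disj[OF that] by auto
      then have "C - f \<in> proper_splits (E - f) S"
        using C by (auto simp: proper_splits_def)
      then show "(C \<inter> f, C - f) \<in> {A \<in> Pow f. P A} \<times> proper_splits (E - f) S"
        using C by simp
    qed
  qed (auto simp: proper_splits_def)
  from bij_betw_same_card[OF this] show ?thesis
    by (simp only: card_cartesian_product)
qed

text \<open>The induction of the Lovasz local lemma: conditioned on every set of \<open>S\<close> being split,
  \<open>f\<close> is monochromatic with probability at most twice the unconditional \<open>2 / 2 ^ k\<close>.\<close>

lemma card_monochromatic_le:
  assumes "finite E" "F \<subseteq> Pow E" and k: "\<And>f. f \<in> F \<Longrightarrow> card f = k" "k > 0"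
    and D: "\<And>f. f \<in> F \<Longrightarrow> card {g \<in> F. g \<inter> f \<noteq> {}} \<le> D" "8 * D \<le> 2 ^ k"
    and "S \<subseteq> F" "f \<in> F"
  shows "2 ^ k * card (proper_splits E S - proper_splits E {f}) \<le> 4 * card (proper_splits E S)"
  using \<open>S \<subseteq> F\<close> \<open>f \<in> F\<close>
proof (induction "card S" arbitrary: S f rule: less_induct)
  case less
  \<comment> \<open>\<open>S1\<close> collects the neighbours of \<open>f\<close> in
    \<open>S\<close>; the remaining \<open>S2\<close> is independent of the colours on
    \<open>f\<close>.\<close>
  define S1 where "S1 = {g \<in> S. g \<inter> f \<noteq> {}}"
  define S2 where "S2 = S - S1"
  have finF: "finite F" using assms(1,2) by (meson finite_Pow_iff finite_subset)
  then have finS: "finite S" using less.prems finite_subset by blast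
  have f: "f \<subseteq> E" "card f = k" "finite f" "f \<noteq> {}"
    using less.prems assms(2) k card_gt_0_iff[of f] by auto
  note card_Int = card_proper_splits_Int[OF \<open>finite E\<close> f(1), of S2]
  have disj: "g \<inter> f = {}" if "g \<in> S2" for g
    using that by (auto simp: S2_def S1_def)
  let ?M = "card (proper_splits (E - f) S2)"
  have N2: "card (proper_splits E S2) = 2 ^ k * ?M"
    using card_Int[of "\<lambda>_. True"] disj f by (simp add: card_Pow flip: Pow_def)
  have "{A \<in> Pow f. A = {} \<or> A = f} = {{}, f}" by auto
  then have "card {A \<in> Pow f. A = {} \<or> A = f} = 2" using f by simp
  then have B2: "card {C \<in> proper_splits E S2. C \<inter> f = {} \<or> C \<inter> f = f} = 2 * ?M"
    using card_Int[of "\<lambda>A. A = {} \<or> A = f"] disj by simp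
  \<comment> \<open>Forgetting the constraints from \<open>S1\<close> only enlarges the bad event,
    and afterwards it factors as in \<open>B2\<close>.\<close>
  have sub: "proper_splits E S - proper_splits E {f}
      \<subseteq> {C \<in> proper_splits E S2. C \<inter> f = {} \<or> C \<inter> f = f}"
  proof
    fix C assume C: "C \<in> proper_splits E S - proper_splits E {f}"
    then have "C \<in> proper_splits E S2"
      using proper_splits_antimono[of S2 S E] by (auto simp: S2_def)
    moreover have "f \<inter> C = {} \<or> f \<subseteq> C"
      using C by (simp add: proper_splits_def)
    ultimately show "C \<in> {C \<in> proper_splits E S2. C \<inter> f = {} \<or> C \<inter> f = f}" by blast
  qed
  have "card (proper_splits E S - proper_splits E {f}) \<le> 2 * ?M"
    using card_mono[OF _ sub] finite_proper_splits[OF \<open>finite E\<close>] unfolding B2 by simp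
  then have bad: "2 ^ k * card (proper_splits E S - proper_splits E {f})
      \<le> 2 * card (proper_splits E S2)"
    unfolding N2 by simp
  \<comment> \<open>Given that \<open>S2\<close> is split, \<open>S1\<close> is split too with
    probability at least 1/2: a union bound over at most \<open>D\<close> neighbours, each
    monochromatic with conditional probability at most \<open>4 / 2 ^ k\<close> by induction, and
    \<open>8 * D \<le> 2 ^ k\<close>.\<close>
  have "card (proper_splits E S2) \<le> 2 * card (proper_splits E S)"
  proof (cases "S1 = {}")
    case True
    then show ?thesis by (simp add: S2_def)
  next
    case False
    then have "card S2 < card S"
      unfolding S2_def by (intro psubset_card_mono finS) (auto simp: S1_def)
    then have IH: "2 ^ k * card (proper_splits E S2 - proper_splits E {g})
        \<le> 4 * card (proper_splits E S2)" if "g \<in> S1" for g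
      using less.hyps[of S2 g] less.prems that by (auto simp: S2_def S1_def)
    have "card S1 \<le> card {g \<in> F. g \<inter> f \<noteq> {}}"
      using less.prems finF by (intro card_mono) (auto simp: S1_def)
    then have S1: "card S1 \<le> D"
      using D(1)[OF less.prems(2)] by linarith
    have "proper_splits E S2 - proper_splits E S
        \<subseteq> (\<Union>g\<in>S1. proper_splits E S2 - proper_splits E {g})"
      unfolding proper_splits_def S2_def by blast
    then have "card (proper_splits E S2 - proper_splits E S)
        \<le> card (\<Union>g\<in>S1. proper_splits E S2 - proper_splits E {g})"
      using finS finite_proper_splits[OF \<open>finite E\<close>] by (intro card_mono) (auto simp: S1_def)
    also have "\<dots> \<le> (\<Sum>g\<in>S1. card (proper_splits E S2 - proper_splits E {g}))"
      using finS by (intro card_UN_le) (simp add: S1_def)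
    finally have "2 ^ k * card (proper_splits E S2 - proper_splits E S)
        \<le> (\<Sum>g\<in>S1. 2 ^ k * card (proper_splits E S2 - proper_splits E {g}))"
      by (simp flip: sum_distrib_left)
    also have "\<dots> \<le> card S1 * (4 * card (proper_splits E S2))"
      using sum_bounded_above[of S1, OF IH] by simp
    also have "\<dots> \<le> D * (4 * card (proper_splits E S2))"
      using S1 by simp
    finally have "2 * (2 ^ k * card (proper_splits E S2 - proper_splits E S))
        \<le> (8 * D) * card (proper_splits E S2)" by simp
    also have "\<dots> \<le> 2 ^ k * card (proper_splits E S2)"
      using D(2) by simp
    finally have "2 ^ k * (2 * card (proper_splits E S2 - proper_splits E S))
        \<le> 2 ^ k * card (proper_splits E S2)" by simp
    then have "2 * card (proper_splits E S2 - proper_splits E S) \<le> card (proper_splits E S2)"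
      by simp
    moreover have "card (proper_splits E S2 - proper_splits E S)
        = card (proper_splits E S2) - card (proper_splits E S)"
      using finite_proper_splits[OF \<open>finite E\<close>] proper_splits_antimono[of S2 S E]
      by (intro card_Diff_subset) (auto simp: S2_def)
    ultimately show ?thesis by linarith
  qed
  with bad show ?case by linarith
qed

text \<open>The sets are added one at a time. If adding \<open>f\<close> destroyed every colouring,
  the conditional probability of \<open>f\<close> being monochromatic would be 1, contradicting the
  bound \<open>4 / 2 ^ k\<close>.\<close>

lemma proper_splits_nonempty:
  assumes "finite E" "F \<subseteq> Pow E" and k: "\<And>f. f \<in> F \<Longrightarrow> card f = k" "k > 0"
    and D: "\<And>f. f \<in> F \<Longrightarrow> card {g \<in> F. g \<inter> f \<noteq> {}} \<le> D" "8 * D \<le> 2 ^ k"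
  shows "proper_splits E F \<noteq> {}"
proof -
  have finF: "finite F" using assms(1,2) by (meson finite_Pow_iff finite_subset)
  have "proper_splits E S \<noteq> {}" if "S \<subseteq> F" for S
    using finite_subset[OF that finF] that
  proof (induction S)
    case empty
    then show ?case by (auto simp: proper_splits_def)
  next
    case (insert f S)
    show ?case
    proof
      assume "proper_splits E (insert f S) = {}"
      then have "proper_splits E S - proper_splits E {f} = proper_splits E S"
        by (auto simp: proper_splits_def)
      then have "2 ^ k * card (proper_splits E S) \<le> 4 * card (proper_splits E S)"
        using card_monochromatic_le[OF assms, of S f] insert.prems by simp
      moreover have "card (proper_splits E S) > 0"
        using insert finite_proper_splits[OF \<open>finite E\<close>] by (simp add: card_gt_0_iff)
      ultimately have "(2::nat) ^ k \<le> 4" by simp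
      \<comment> \<open>\<open>f\<close> is nonempty and so meets itself; hence
        \<open>D \<ge> 1\<close> and \<open>2 ^ k \<ge> 8\<close>.\<close>
      moreover have "f \<in> {g \<in> F. g \<inter> f \<noteq> {}}"
        using insert.prems k by force
      then have "D > 0"
        using D(1)[of f] insert.prems finF card_gt_0_iff[of "{g \<in> F. g \<inter> f \<noteq> {}}"] by fastforce
      ultimately show False using D(2) by linarith
    qed
  qed
  then show ?thesis by simp
qed

section \<open>Copies of the suspension of a complete graph\<close>

text \<open>For disjoint \<open>U\<close> and \<open>T\<close>, the edges of the copy of the
  suspension with apex set \<open>U\<close> and clique \<open>T\<close>, placed directly in the host
  vertex set without the sum type.\<close>

definition susp_edges :: "'a set \<Rightarrow> 'a set \<Rightarrow> 'a set set" where
  "susp_edges U T = (\<lambda>e. e \<union> U) ` nsets T 2"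

lemma card_susp_edges:
  assumes "U \<inter> T = {}"
  shows "card (susp_edges U T) = card T choose 2"
proof -
  have "inj_on (\<lambda>e. e \<union> U) (nsets T 2)"
    using assms by (auto simp: inj_on_def nsets_def)
  then show ?thesis
    by (simp add: susp_edges_def card_image)
qed

text \<open>The isomorphism carries the two summands of the vertex type to an apex set and a
  clique.\<close>

lemma monochromatic_copy_suspensionE:
  assumes "has_monochromatic_copy c i (complete_hypergraph r n) (suspension r (complete_graph t))"
  obtains U T where "U \<in> nsets {..<n} (r - 2)" "T \<in> nsets {..<n} t" "U \<inter> T = {}"
    "\<And>e. e \<in> susp_edges U T \<Longrightarrow> c e = i"
proof -
  define A :: "(nat + nat) set" where "A = Inl ` {..<t}"
  define B :: "(nat + nat) set" where "B = Inr ` {..<r - 2}"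
  obtain H where sub: "subhypergraph H (complete_hypergraph r n)"
    and H: "\<And>e. e \<in> hedges H \<Longrightarrow> c e = i"
    and iso: "hypergraph_iso (suspension r (complete_graph t)) H"
    using assms unfolding has_monochromatic_copy_def by blast
  have Hn: "hverts H \<subseteq> {..<n}"
    using sub by (simp add: subhypergraph_def complete_hypergraph_def)
  obtain f where f: "bij_betw f (A \<union> B) (hverts H)"
    and edges: "hedges H = (\<lambda>e. f ` e) ` (\<lambda>e. Inl ` e \<union> B) ` nsets {..<t} 2"
    using iso unfolding hypergraph_iso_def complete_hypergraph_def suspension_def
      Let_def A_def B_def fst_conv snd_conv by blast
  have inj: "inj_on f A" "inj_on f B" and im: "f ` (A \<union> B) = hverts H"
    using f by (auto simp: bij_betw_def inj_on_Un)
  have cards: "card A = t" "card B = r - 2" "finite A" "finite B"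
    by (auto simp: A_def B_def card_image)
  have inj': "inj_on (f \<circ> Inl) {..<t}"
    using inj(1) by (intro comp_inj_on) (auto simp: A_def)
  show ?thesis
  proof
    show "f ` B \<in> nsets {..<n} (r - 2)" "f ` A \<in> nsets {..<n} t"
      using inj im cards Hn by (auto simp: nsets_def card_image)
    show "f ` B \<inter> f ` A = {}"
      using inj_on_image_Int[of f "A \<union> B" B A] bij_betw_imp_inj_on[OF f]
      by (auto simp: A_def B_def)
    have fA: "f ` A = (f \<circ> Inl) ` {..<t}" by (simp add: A_def image_comp)
    fix e assume "e \<in> susp_edges (f ` B) (f ` A)"
    then obtain p where p: "p \<in> nsets ((f \<circ> Inl) ` {..<t}) 2" "e = p \<union> f ` B"
      unfolding susp_edges_def fA by blast
    \<comment> \<open>\<open>f \<circ> Inl\<close> is injective, so each pair in the image clique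
      comes from an edge of the abstract complete graph.\<close>
    then obtain q where "q \<in> nsets {..<t} 2" "p = (f \<circ> Inl) ` q"
      using bij_betw_imp_surj_on[OF bij_betw_nsets[OF inj_on_imp_bij_betw[OF inj'], of 2]] by blast
    then have "e \<in> hedges H"
      unfolding edges p image_image by (intro image_eqI[of _ _ q]) (auto simp: image_Un)
    then show "c e = i" by (rule H)
  qed
qed

text \<open>A copy through \<open>x\<close> is determined by its apex set \<open>U\<close>, which
  lies in \<open>x\<close>, and by its \<open>t - 2\<close> clique vertices outside
  \<open>x\<close>; the other two clique vertices form \<open>x - U\<close>.\<close>

lemma card_susp_edges_through_le:
  assumes "card x = r" "r \<ge> 2" "t \<ge> 2"
    and F: "F = {susp_edges U T |U T. U \<in> nsets {..<n} (r - 2) \<and> T \<in> nsets {..<n} t \<and> U \<inter> T = {}}"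
  shows "card {g \<in> F. x \<in> g} \<le> (r choose (r - 2)) * (n choose (t - 2))"
proof -
  \<comment> \<open>Infinite sets have cardinality 0, which \<open>r \<ge> 2\<close>
    excludes.\<close>
  have fx: "finite x" using assms card_ge_0_finite by fastforce
  let ?I = "nsets x (r - 2) \<times> nsets {..<n} (t - 2)"
  have "{g \<in> F. x \<in> g} \<subseteq> (\<lambda>(U, W). susp_edges U ((x - U) \<union> W)) ` ?I"
  proof clarify
    fix g assume "g \<in> F" "x \<in> g"
    then obtain U T e where UT: "g = susp_edges U T" "U \<in> nsets {..<n} (r - 2)"
        "T \<in> nsets {..<n} t" "U \<inter> T = {}" and e: "e \<in> nsets T 2" "x = e \<union> U"
      unfolding F susp_edges_def by auto
    have xU: "x - U = e" using e UT by (auto simp: nsets_def)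
    have "U \<in> nsets x (r - 2)" using UT e by (auto simp: nsets_def)
    moreover have "T - e \<in> nsets {..<n} (t - 2)"
      using UT e by (auto simp: nsets_def card_Diff_subset)
    moreover have "T = (x - U) \<union> (T - e)"
      using e unfolding xU by (auto simp: nsets_def)
    ultimately show "g \<in> (\<lambda>(U, W). susp_edges U ((x - U) \<union> W)) ` ?I"
      using UT(1) by (intro image_eqI[of _ _ "(U, T - e)"]) auto
  qed
  moreover have fin: "finite ?I" using fx by (simp add: finite_imp_finite_nsets)
  ultimately have "card {g \<in> F. x \<in> g} \<le> card ?I"
    by (meson card_image_le card_mono finite_imageI order_trans)
  then show ?thesis using assms by (simp add: card_cartesian_product)
qed

text \<open>The local lemma applied to the edge sets of all copies, with
  \<open>k = t choose 2\<close>.\<close>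

lemma no_monochromatic_suspension:
  assumes "r \<ge> 2" "t \<ge> 2"
    and bound: "8 * ((t choose 2) * ((r choose (r - 2)) * (n choose (t - 2)))) \<le> 2 ^ (t choose 2)"
  shows "\<exists>c. \<forall>i. \<not> has_monochromatic_copy c i (complete_hypergraph r n) (suspension r (complete_graph t))"
proof -
  define F :: "nat set set set" where
    "F = {susp_edges U T |U T. U \<in> nsets {..<n} (r - 2) \<and> T \<in> nsets {..<n} t \<and> U \<inter> T = {}}"
  let ?b = "(r choose (r - 2)) * (n choose (t - 2))"
  have cardF: "card f = t choose 2" if "f \<in> F" for f
    using that by (auto simp: F_def card_susp_edges nsets_def)
  have sub: "f \<subseteq> nsets {..<n} r" if "f \<in> F" for f
  proof
    fix x assume "x \<in> f"
    then obtain U T e where x: "x = e \<union> U" "e \<subseteq> T" "finite e" "card e = 2"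
      and UT: "U \<subseteq> {..<n}" "finite U" "card U = r - 2" "T \<subseteq> {..<n}" "U \<inter> T = {}"
      using \<open>f \<in> F\<close> unfolding F_def susp_edges_def nsets_def by blast
    then have "e \<inter> U = {}" by blast
    then have "card x = card e + card U"
      using x UT by (simp add: card_Un_disjoint)
    then show "x \<in> nsets {..<n} r"
      using x UT \<open>r \<ge> 2\<close> by (auto simp: nsets_def)
  qed
  have finE: "finite (nsets {..<n} r)" by (simp add: finite_imp_finite_nsets)
  have finF: "finite F" using sub finE by (meson PowI finite_Pow_iff finite_subset subsetI)
  have pos: "t choose 2 > 0" using \<open>t \<ge> 2\<close> by simp
  \<comment> \<open>Every copy meeting \<open>f\<close> passes through one of the
    \<open>t choose 2\<close> edges of \<open>f\<close>.\<close>
  have "card {g \<in> F. g \<inter> f \<noteq> {}} \<le> (t choose 2) * ?b" if f: "f \<in> F" for f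
  proof -
    have finf: "finite f" using sub[OF f] finE finite_subset by blast
    have "{g \<in> F. g \<inter> f \<noteq> {}} \<subseteq> (\<Union>x\<in>f. {g \<in> F. x \<in> g})" by auto
    then have "card {g \<in> F. g \<inter> f \<noteq> {}} \<le> card (\<Union>x\<in>f. {g \<in> F. x \<in> g})"
      using finf finF by (intro card_mono) auto
    also have "\<dots> \<le> (\<Sum>x\<in>f. card {g \<in> F. x \<in> g})"
      using finf by (rule card_UN_le)
    also have "\<dots> \<le> card f * ?b"
      using sub[OF f] assms F_def card_susp_edges_through_le[of _ r t F n]
      by (intro sum_bounded_above[where K = ?b, simplified]) (auto simp: nsets_def)
    finally show ?thesis using cardF[OF f] by simp
  qed
  then obtain C where C: "C \<in> proper_splits (nsets {..<n} r) F"
    using proper_splits_nonempty[OF finE _ cardF pos _ bound] sub by blast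
  have "\<not> has_monochromatic_copy (\<lambda>e. e \<in> C) i (complete_hypergraph r n) (suspension r (complete_graph t))"
    for i
  proof
    assume "has_monochromatic_copy (\<lambda>e. e \<in> C) i (complete_hypergraph r n) (suspension r (complete_graph t))"
    then obtain U T where UT: "U \<in> nsets {..<n} (r - 2)" "T \<in> nsets {..<n} t" "U \<inter> T = {}"
      "\<And>e. e \<in> susp_edges U T \<Longrightarrow> (e \<in> C) = i"
      by (rule monochromatic_copy_suspensionE) blast
    then have "susp_edges U T \<in> F" by (auto simp: F_def)
    \<comment> \<open>Colour \<open>True\<close> would put the whole edge set inside
      \<open>C\<close>, colour \<open>False\<close> would make it miss \<open>C\<close>.\<close>
    then show False
      using C UT(4) by (cases i) (auto simp: proper_splits_def)
  qed
  then show ?thesis by blast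
qed

section \<open>Ramsey numbers\<close>

text \<open>This lets one good colouring on \<open>n\<close> vertices rule out every Ramsey number
  up to \<open>n\<close>.\<close>

lemma has_monochromatic_copy_mono:
  assumes "has_monochromatic_copy c i (complete_hypergraph r m) F" "m \<le> n"
  shows "has_monochromatic_copy c i (complete_hypergraph r n) F"
proof -
  have "{..<m} \<subseteq> {..<n}" using \<open>m \<le> n\<close> by auto
  then have "subhypergraph H (complete_hypergraph r n)" if "subhypergraph H (complete_hypergraph r m)" for H
    using that nsets_mono[of "{..<m}" "{..<n}" r] by (auto simp: subhypergraph_def complete_hypergraph_def)
  then show ?thesis
    using assms(1) unfolding has_monochromatic_copy_def by blast
qed

lemma monochromatic_suspension_copy:
  assumes "r \<ge> 2"
    and copy: "has_monochromatic_copy (\<lambda>e. c (e \<union> {N..<N + (r - 2)})) i (complete_graph N) G"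
  shows "has_monochromatic_copy c i (complete_hypergraph r (N + (r - 2))) (suspension r G)"
proof -
  define U where "U = {N..<N + (r - 2)}"
  obtain H where "subhypergraph H (complete_graph N)" "\<forall>e\<in>hedges H. c (e \<union> U) = i"
    "hypergraph_iso G H"
    using copy unfolding has_monochromatic_copy_def U_def by blast
  then have H: "hverts H \<subseteq> {..<N}" "hedges H \<subseteq> nsets {..<N} 2" "hedges H \<subseteq> Pow (hverts H)"
    and col: "\<And>e. e \<in> hedges H \<Longrightarrow> c (e \<union> U) = i"
    and iso: "hypergraph_iso G H"
    by (simp_all add: subhypergraph_def complete_hypergraph_def)
  obtain f where f: "bij_betw f (hverts G) (hverts H)" "hedges H = (\<lambda>e. f ` e) ` hedges G"
    using iso unfolding hypergraph_iso_def by blast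
  define H' where "H' = (hverts H \<union> U, (\<lambda>e. e \<union> U) ` hedges H)"
  \<comment> \<open>The added vertices go to the top \<open>r - 2\<close> vertices of the host,
    beyond the image of \<open>f\<close>.\<close>
  define h where "h = case_sum f (\<lambda>j. N + j)"
  have hU: "h ` Inr ` {..<r - 2} = U"
    by (auto simp: h_def U_def image_image lessThan_atLeast0)
  have hInl: "h ` Inl ` X = f ` X" for X
    by (auto simp: h_def image_image)
  have edge: "e \<union> U \<in> nsets {..<N + (r - 2)} r" if "e \<in> hedges H" for e
  proof -
    have e: "e \<subseteq> {..<N}" "finite e" "card e = 2" using that H(2) by (auto simp: nsets_def)
    then have "card (e \<union> U) = card e + card U"
      by (intro card_Un_disjoint) (auto simp: U_def)
    then show ?thesis using e \<open>r \<ge> 2\<close> by (auto simp: nsets_def U_def)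
  qed
  have "subhypergraph H' (complete_hypergraph r (N + (r - 2)))"
    using H edge by (auto simp: subhypergraph_def complete_hypergraph_def H'_def U_def)
  moreover have "\<forall>e\<in>hedges H'. c e = i"
    using col by (auto simp: H'_def)
  moreover have "hypergraph_iso (suspension r G) H'"
    unfolding hypergraph_iso_def
  proof (intro exI[of _ h] conjI)
    have "inj_on h (Inl ` hverts G \<union> Inr ` {..<r - 2})"
    proof (subst inj_on_Un, intro conjI)
      show "inj_on h (Inl ` hverts G)" "inj_on h (Inr ` {..<r - 2})"
        using f(1) by (auto simp: h_def bij_betw_def inj_on_def)
      have "f ` hverts G \<subseteq> {..<N}" using f(1) H(1) by (simp add: bij_betw_def)
      then show "h ` (Inl ` hverts G - Inr ` {..<r - 2}) \<inter> h ` (Inr ` {..<r - 2} - Inl ` hverts G) = {}"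
        by (force simp: h_def)
    qed
    then show "bij_betw h (hverts (suspension r G)) (hverts H')"
      using f(1) by (simp add: bij_betw_def suspension_def Let_def H'_def image_Un hU hInl)
    show "hedges H' = (\<lambda>e. h ` e) ` hedges (suspension r G)"
      by (simp add: H'_def suspension_def Let_def f(2) image_image image_Un
          hU[unfolded image_image] hInl[unfolded image_image])
  qed
  ultimately show ?thesis
    unfolding has_monochromatic_copy_def by blast
qed

text \<open>Without a witness \<open>LEAST\<close> would be meaningless; Ramsey's theorem for pairs
  with two colours supplies one.\<close>

lemma graph_ramsey_exists:
  "\<exists>N. \<forall>c. has_monochromatic_copy c True (complete_graph N) (complete_graph t)
         \<or> has_monochromatic_copy c False (complete_graph N) (complete_graph t)"
proof -
  obtain N :: nat where N: "partn_lst {..<N} [t, t] 2"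
    using ramsey2_full by blast
  have "\<exists>i. has_monochromatic_copy c i (complete_graph N) (complete_graph t)" for c
  proof -
    define d :: "nat set \<Rightarrow> nat" where "d e = (if c e then 0 else 1)" for e
    have "d \<in> nsets {..<N} 2 \<rightarrow> {..<length [t, t]}" by (auto simp: d_def)
    then obtain j where j: "j < length [t, t]" "monochromatic {..<N} ([t, t] ! j) 2 d j"
      using N unfolding partn_lst_def by blast
    then obtain T where T: "T \<in> nsets {..<N} ([t, t] ! j)"
      and mono: "\<And>e. e \<in> nsets T 2 \<Longrightarrow> d e = j"
      unfolding monochromatic_def by blast
    \<comment> \<open>Both entries of \<open>[t, t]\<close> are \<open>t\<close>, so either colour
      gives a clique of the same size.\<close>
    from j(1) T have T': "T \<subseteq> {..<N}" "finite T" "card T = t"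
      by (auto simp: nsets_def less_Suc_eq)
    then obtain f where f: "bij_betw f {..<t} T"
      using ex_bij_betw_nat_finite[of T] by (auto simp: lessThan_atLeast0)
    have "hypergraph_iso (complete_graph t) (T, nsets T 2)"
      using f bij_betw_nsets[OF f, of 2]
      by (auto simp: hypergraph_iso_def complete_hypergraph_def bij_betw_def)
    moreover have "subhypergraph (T, nsets T 2) (complete_graph N)"
      using T' nsets_mono[OF T'(1)]
      by (auto simp: subhypergraph_def complete_hypergraph_def nsets_def)
    moreover have "\<forall>e\<in>nsets T 2. c e = (j = 0)"
      using mono unfolding d_def by (metis zero_neq_one)
    ultimately show ?thesis
      unfolding has_monochromatic_copy_def by (metis snd_conv)
  qed
  then show ?thesis by (metis (full_types))
qed

text \<open>Serves twice: it gives the upper bound, and it shows that the least value for the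
  suspension is attained.\<close>

lemma suspension_ramsey_property:
  fixes r t :: nat
  assumes "r \<ge> 2"
  defines "N \<equiv> hypergraph_ramsey 2 (complete_graph t) (complete_graph t)"
  shows "has_monochromatic_copy c True (complete_hypergraph r (N + (r - 2))) (suspension r (complete_graph t))
       \<or> has_monochromatic_copy c False (complete_hypergraph r (N + (r - 2))) (suspension r (complete_graph t))"
proof -
  have "\<forall>c. has_monochromatic_copy c True (complete_graph N) (complete_graph t)
         \<or> has_monochromatic_copy c False (complete_graph N) (complete_graph t)"
    unfolding N_def hypergraph_ramsey_def by (rule LeastI_ex[OF graph_ramsey_exists])
  then show ?thesis
    using monochromatic_suspension_copy[OF \<open>r \<ge> 2\<close>] by blast
qed

lemma suspension_ramsey_le:
  assumes "r \<ge> 2"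
  shows "hypergraph_ramsey r (suspension r (complete_graph t)) (suspension r (complete_graph t))
       \<le> hypergraph_ramsey 2 (complete_graph t) (complete_graph t) + (r - 2)"
  unfolding hypergraph_ramsey_def[of r]
  by (intro Least_le allI suspension_ramsey_property[OF assms])

lemma suspension_ramsey_gt:
  assumes "r \<ge> 2" "t \<ge> 2"
    and "8 * ((t choose 2) * ((r choose (r - 2)) * (n choose (t - 2)))) \<le> 2 ^ (t choose 2)"
  shows "n < hypergraph_ramsey r (suspension r (complete_graph t)) (suspension r (complete_graph t))"
    (is "n < ?R")
proof (rule ccontr)
  assume "\<not> n < ?R"
  then have "?R \<le> n" by simp
  let ?P = "\<lambda>N. \<forall>c :: nat set \<Rightarrow> bool.
      has_monochromatic_copy c True (complete_hypergraph r N) (suspension r (complete_graph t)) \<or>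
      has_monochromatic_copy c False (complete_hypergraph r N) (suspension r (complete_graph t))"
  have "\<exists>N. ?P N" using suspension_ramsey_property[OF \<open>r \<ge> 2\<close>] by blast
  then have "?P ?R" unfolding hypergraph_ramsey_def by (rule LeastI_ex)
  then show False
    using no_monochromatic_suspension[OF assms] has_monochromatic_copy_mono[OF _ \<open>?R \<le> n\<close>]
    by blast
qed

section \<open>Asymptotics\<close>

text \<open>The left side divided by \<open>fact m\<close> is a single term of the exponential
  series at \<open>m\<close>. This weak form of Stirling's formula is the source of the factor
  \<open>1 / exp 1\<close>.\<close>

lemma power_self_le_exp_fact: "real m ^ m \<le> exp 1 ^ m * fact m"
proof -
  have "real m ^ m / fact m \<le> exp (real m)"
  proof -
    have "(\<Sum>k\<in>{m}. real m ^ k /\<^sub>R fact k) \<le> exp (real m)"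
      unfolding exp_def
      by (intro sum_le_suminf summable_exp_generic) auto
    then show ?thesis by (simp add: divide_inverse mult.commute)
  qed
  also have "exp (real m) = exp 1 ^ m"
    by (simp flip: exp_of_nat_mult)
  finally show ?thesis by (simp add: field_simps)
qed

text \<open>With \<open>m = t - 2\<close>, the bounds \<open>n choose m \<le> n ^ m / fact m\<close>
  and \<open>fact m \<ge> (m / exp 1) ^ m\<close> reduce the condition to an upper bound on
  \<open>n ^ m\<close>, and the bound on \<open>n\<close> is its \<open>m\<close>-th root.\<close>

lemma local_lemma_condition:
  fixes R :: nat
  assumes "t \<ge> 3" "R > 0"
    and n: "real n \<le> (real t - 2) / real t * (2 * real R * real t ^ 2) powr (- 1 / (real t - 2))
             * (sqrt 2 / exp 1) * real t * sqrt 2 ^ t" (is "_ \<le> ?x")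
  shows "8 * ((t choose 2) * (R * (n choose (t - 2)))) \<le> 2 ^ (t choose 2)"
proof -
  define m where "m = t - 2"
  \<comment> \<open>\<open>2 * a = 4 * R * t ^ 2\<close> dominates the polynomial factor
    \<open>8 * (t choose 2) * R\<close>.\<close>
  define a where "a = 2 * real R * real t ^ 2"
  have m: "m > 0" "t = m + 2" using assms by (auto simp: m_def)
  have a: "a > 0" using assms by (simp add: a_def)
  have "even (t * (t - 1))" by auto
  then have c0: "2 * (t choose 2) = t * (t - 1)"
    unfolding choose_two by simp
  \<comment> \<open>Dividing this exponent of \<open>sqrt 2\<close> by \<open>m\<close> leaves
    \<open>t + 1\<close>, whence the constant \<open>sqrt 2\<close> beside
    \<open>sqrt 2 ^ t\<close>; the remainder 2 pays for the factor 2 in front of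
    \<open>a\<close>.\<close>
  then have c: "2 * (t choose 2) = (t + 1) * m + 2"
    unfolding m(2) by (simp add: algebra_simps)
  have x: "?x = real m * sqrt 2 ^ (t + 1) / exp 1 * a powr (- 1 / real m)"
    using m by (simp add: a_def)
  have apow: "(a powr (- 1 / real m)) ^ m = inverse a"
  proof -
    have "(a powr (- 1 / real m)) ^ m = (a powr (- 1 / real m)) powr real m"
      using a by (intro powr_realpow[symmetric]) simp
    also have "\<dots> = inverse a"
      unfolding powr_powr using m a by (simp add: powr_minus)
    finally show ?thesis .
  qed
  have "?x ^ m = real m ^ m * sqrt 2 ^ ((t + 1) * m) / exp 1 ^ m * inverse a"
    by (simp only: x power_mult_distrib power_divide power_mult apow)
  also have "\<dots> = real m ^ m / exp 1 ^ m * (sqrt 2 ^ ((t + 1) * m) * inverse a)"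
    by simp
  also have "\<dots> \<le> fact m * (sqrt 2 ^ ((t + 1) * m) * inverse a)"
  proof (rule mult_right_mono)
    show "real m ^ m / exp 1 ^ m \<le> fact m"
      using power_self_le_exp_fact[of m] by (simp add: divide_le_eq mult.commute)
  qed (use a in simp)
  finally have xm: "?x ^ m \<le> fact m * (sqrt 2 ^ ((t + 1) * m) * inverse a)" .
  have "real ((n choose m) * fact m) \<le> real (n ^ m)"
    unfolding of_nat_le_iff by (rule binomial_fact_pow)
  then have "real (n choose m) * fact m \<le> real n ^ m" by simp
  also have "\<dots> \<le> ?x ^ m" using n by (intro power_mono) auto
  also note xm
  finally have "real (n choose m) * a \<le> sqrt 2 ^ ((t + 1) * m)"
    using a by (simp add: field_simps)
  then have "2 * (real (n choose m) * a) \<le> sqrt 2 ^ ((t + 1) * m) * sqrt 2 ^ 2"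
    by simp
  also have "\<dots> = sqrt 2 ^ (2 * (t choose 2))"
    by (simp only: c power_add)
  also have "\<dots> = 2 ^ (t choose 2)"
    by (simp add: power_mult)
  finally have *: "4 * real t ^ 2 * (real R * real (n choose m)) \<le> 2 ^ (t choose 2)"
    by (simp add: a_def algebra_simps)
  have "2 * (t choose 2) \<le> t ^ 2"
    unfolding c0 by (simp add: power2_eq_square)
  then have "real (2 * (t choose 2)) \<le> real (t ^ 2)" unfolding of_nat_le_iff .
  then have "8 * real (t choose 2) \<le> 4 * real t ^ 2" by simp
  then have "8 * real (t choose 2) * (real R * real (n choose m)) \<le> 2 ^ (t choose 2)"
    using * by (meson mult_right_mono of_nat_0_le_iff mult_nonneg_nonneg order_trans)
  then have "real (8 * ((t choose 2) * (R * (n choose m)))) \<le> real (2 ^ (t choose 2))"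
    by (simp add: mult.assoc)
  then show ?thesis unfolding of_nat_le_iff m_def .
qed

theorem theorem1p14:
  fixes r :: nat
  assumes "r \<ge> 3"
  shows "(\<exists>\<epsilon> :: nat \<Rightarrow> real. \<epsilon> \<in> o(\<lambda>_. 1) \<and>
           (\<forall>\<^sub>F t in sequentially.
              (1 + \<epsilon> t) * (sqrt 2 / exp 1) * real t * sqrt 2 ^ t
                < real (hypergraph_ramsey r (suspension r (complete_graph t))
                                            (suspension r (complete_graph t)))))
       \<and> (\<forall>t. hypergraph_ramsey r (suspension r (complete_graph t))
                                  (suspension r (complete_graph t))
              \<le> hypergraph_ramsey 2 (complete_graph t) (complete_graph t) + (r - 2))"
proof (intro conjI allI)
  fix t
  show "hypergraph_ramsey r (suspension r (complete_graph t)) (suspension r (complete_graph t))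
      \<le> hypergraph_ramsey 2 (complete_graph t) (complete_graph t) + (r - 2)"
    using assms by (intro suspension_ramsey_le) simp
next
  define R where "R = r choose (r - 2)"
  have R: "R > 0" by (simp add: R_def)
  \<comment> \<open>Chosen so that \<open>1 + \<epsilon> t\<close> is exactly the correction factor
    in \<open>local_lemma_condition\<close>; it tends to 1 because a fixed polynomial in
    \<open>t\<close> to the power \<open>- 1 / (t - 2)\<close> does.\<close>
  define \<epsilon> where "\<epsilon> t = (real t - 2) / real t
      * (2 * real R * real t ^ 2) powr (- 1 / (real t - 2)) - 1" for t :: nat
  have "(\<epsilon> \<longlongrightarrow> 0) sequentially"
    unfolding \<epsilon>_def using R by real_asymp
  then have "\<epsilon> \<in> o(\<lambda>_. 1)" by (simp add: smalloI_tendsto)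
  moreover have "(1 + \<epsilon> t) * (sqrt 2 / exp 1) * real t * sqrt 2 ^ t
      < real (hypergraph_ramsey r (suspension r (complete_graph t)) (suspension r (complete_graph t)))"
    (is "?x < real ?N") if "t \<ge> 3" for t
  proof -
    \<comment> \<open>Nonnegativity matters because \<open>nat\<close> truncates negative integers
      to 0.\<close>
    have "?x \<ge> 0" using that by (simp add: \<epsilon>_def)
    then have "real (nat \<lfloor>?x\<rfloor>) \<le> ?x" by simp
    then have "nat \<lfloor>?x\<rfloor> < ?N"
      using that assms R
      by (intro suspension_ramsey_gt local_lemma_condition[of t R, unfolded R_def]) (auto simp: \<epsilon>_def R_def)
    \<comment> \<open>\<open>?N\<close> is an integer above the floor of \<open>?x\<close>, hence
      strictly above \<open>?x\<close> itself.\<close>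
    then show ?thesis by linarith
  qed
  then have "\<forall>\<^sub>F t in sequentially. (1 + \<epsilon> t) * (sqrt 2 / exp 1) * real t * sqrt 2 ^ t
      < real (hypergraph_ramsey r (suspension r (complete_graph t)) (suspension r (complete_graph t)))"
    by (rule eventually_sequentiallyI)
  ultimately show "\<exists>\<epsilon> :: nat \<Rightarrow> real. \<epsilon> \<in> o(\<lambda>_. 1) \<and>
      (\<forall>\<^sub>F t in sequentially. (1 + \<epsilon> t) * (sqrt 2 / exp 1) * real t * sqrt 2 ^ t
        < real (hypergraph_ramsey r (suspension r (complete_graph t)) (suspension r (complete_graph t))))"
    by blast
qed

end
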